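(* Let $W$ be an irreducible $T$-module with endpoint $r$ and diameter $d=D-2r$. Then the following hold for $0\le i,j\le d$ and nonzero vectors $u\in E_rW$, $u^*\in E^*_rW$, $u^{\varepsilon}\in E^{\varepsilon}_rW$. (i) $$\langle E_{r+i}u^*,E^{\varepsilon}_{r+j}u^*\rangle=\mathbf{i}^{-i-j}(2-2\mathbf{i})^{-d}\|u^*\|^2\binom{d}{i}\binom{d}{j}\;{}_2F_1\Big({-i,-j\atop -d};2\Big).$$ (ii) $$\langle E^*_{r+i}u^{\varepsilon},E_{r+j}u^{\varepsilon}\rangle=\mathbf{i}^{-i-j}(2-2\mathbf{i})^{-d}\|u^{\varepsilon}\|^2\binom{d}{i}\binom{d}{j}\;{}_2F_1\Big({-i,-j\atop -d};2\Big).$$ (iii) $$\langle E^{\varepsilon}_{r+i}u,E^*_{r+j}u\rangle=\mathbf{i}^{-i-j}(2-2\mathbf{i})^{-d}\|u\|^2\binom{d}{i}\binom{d}{j}\;{}_2F_1\Big({-i,-j\atop -d};2\Big).$$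
   Context: Let $D$ be a positive integer and let $Q_D$ be the $D$-cube: the graph with vertex set $X=\{0,1\}^D$, two vertices being adjacent iff they differ in exactly one coordinate; $\partial$ denotes path-length distance. $\mathrm{Mat}_X(\mathbb{C})$ is the algebra of complex matrices with rows and columns indexed by $X$, acting on $V=\mathbb{C}^X$ (column vectors) by left multiplication. $V$ carries the Hermitian inner product $\langle v,w\rangle=v^t\overline{w}$ (linear in the first argument), with $\|v\|^2=\langle v,v\rangle$. Write $\mathbf{i}^2=-1$ (the bold $\mathbf{i}$ is the imaginary unit; the plain $i$ is an index). Let $A$ be the adjacency matrix of $Q_D$. Fix $x=(0,0,\ldots,0)\in X$. Let $A^*$ be the diagonal matrix in $\mathrm{Mat}_X(\mathbb{C})$ with $(y,y)$-entry $D-2\partial(x,y)$ for $y\in X$, and let $A^{\varepsilon}=-\mathbf{i}(AA^*-A^*A)/2$. Let $T$ be the subalgebra of $\mathrm{Mat}_X(\mathbb{C})$ generated by $A$ and $A^*$. The eigenvalues of $A$ are $\theta_i=D-2i$ $(0\le i\le D)$. For $0\le i\le D$: $E_i=\prod_{0\le j\le D,\,j\ne i}\frac{A-\theta_jI}{\theta_i-\theta_j}$ is the primitive idempotent of $A$ for $\theta_i$ (the orthogonal projection onto the $\theta_i$-eigenspace of $A$); $E_i^*$ is the diagonal matrix with $(y,y)$-entry $1$ if $\partial(x,y)=i$ and $0$ otherwise; and $E_i^{\varepsilon}=P^{-1}E_iP$, where $P=P_1^{\otimes D}$ (Kronecker power, $P_{yz}=\prod_{k=1}^D(P_1)_{y_kz_k}$,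 invertible) with $P_1=\begin{pmatrix}1&1\\-\mathbf{i}&\mathbf{i}\end{pmatrix}$, rows and columns indexed by $0,1$ in that order. ($E_i^*$ and $E_i^{\varepsilon}$ are the primitive idempotents of $A^*$ and $A^{\varepsilon}$ for the eigenvalue $D-2i$.) A $T$-module is a subspace $W\subseteq V$ with $BW\subseteq W$ for all $B\in T$; it is irreducible if $W\ne0$ and it contains no $T$-modules other than $0$ and $W$. The endpoint of an irreducible $T$-module $W$ is $r=\min\{i\mid 0\le i\le D,\ E_i^*W\neq0\}$ (it is known that also $r=\min\{i\mid E_iW\ne0\}$), and its diameter is $d=|\{i\mid 0\le i\le D,\ E_i^*W\ne0\}|-1$; it is known that $d=D-2r$ and $0\le r\le D/2$. For $a\in\mathbb{C}$ and an integer $n\ge0$, $(a)_n=a(a+1)\cdots(a+n-1)$ with $(a)_0=1$. For integers $0\le i,j\le d$, ${}_2F_1\big({-i,-j\atop -d};2\big)=\sum_{n=0}^d\frac{(-i)_n(-j)_n}{(-d)_n\,n!}2^n$. *)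

theory Defs
  imports "HOL-Analysis.Analysis"
begin

text \<open>
  The coordinates of the cube are indexed by a finite type \<open>'n\<close>, so that
  $D = $ \<open>CARD('n)\<close>, which is positive. In a vertex, \<open>False\<close> encodes the
  coordinate $0$ and \<open>True\<close> the coordinate $1$.
\<close>

type_synonym 'n vertex = "bool ^ 'n"
type_synonym 'n cvec = "complex ^ ('n vertex)"
type_synonym 'n cmat = "complex ^ ('n vertex) ^ ('n vertex)"

definition cube_adj :: "'n::finite vertex \<Rightarrow> 'n vertex \<Rightarrow> bool" where
  "cube_adj y z \<longleftrightarrow> card {k. y $ k \<noteq> z $ k} = 1"

text \<open>\<open>(cube_adj ^^ m) y z\<close> says that there is a walk of length \<open>m\<close> from \<open>y\<close> to \<open>z\<close>.\<close>

definition cube_dist :: "'n::finite vertex \<Rightarrow> 'n vertex \<Rightarrow> nat" where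
  "cube_dist y z = (LEAST m. (cube_adj ^^ m) y z)"

definition base_vertex :: "'n::finite vertex" where
  "base_vertex = (\<chi> k. False)"

definition herm :: "complex ^ 'a \<Rightarrow> complex ^ 'a \<Rightarrow> complex" where
  "herm v w = (\<Sum>y\<in>UNIV. v $ y * cnj (w $ y))"

lemma herm_self: "herm v v = complex_of_real ((norm v)\<^sup>2)"
  unfolding herm_def norm_vec_def L2_set_def
  by (simp add: sum_nonneg complex_norm_square [symmetric])

definition mscale :: "complex \<Rightarrow> complex ^ 'a ^ 'b \<Rightarrow> complex ^ 'a ^ 'b" where
  "mscale c M = (\<chi> y z. c * M $ y $ z)"

definition adj_mat :: "'n::finite cmat" where
  "adj_mat = (\<chi> y z. if cube_adj y z then 1 else 0)"

definition theta :: "'n::finite itself \<Rightarrow> nat \<Rightarrow> complex" where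
  "theta _ i = of_nat CARD('n) - 2 * of_nat i"

definition dual_adj_mat :: "'n::finite cmat" where
  "dual_adj_mat = (\<chi> y z. if y = z
     then of_nat CARD('n) - 2 * of_nat (cube_dist base_vertex y) else 0)"

text \<open>The subalgebra of the matrix algebra generated by \<open>adj_mat\<close> and \<open>dual_adj_mat\<close>.\<close>

inductive_set T_alg :: "('n::finite cmat) set" where
  one: "mat 1 \<in> T_alg"
| adj: "adj_mat \<in> T_alg"
| dual_adj: "dual_adj_mat \<in> T_alg"
| add: "B \<in> T_alg \<Longrightarrow> C \<in> T_alg \<Longrightarrow> B + C \<in> T_alg"
| scale: "B \<in> T_alg \<Longrightarrow> mscale c B \<in> T_alg"
| mult: "B \<in> T_alg \<Longrightarrow> C \<in> T_alg \<Longrightarrow> B ** C \<in> T_alg"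

text \<open>
  The three families of idempotents below are only meaningful for indices
  $0 \le i \le D$. The product is spelled out over a list because the
  \<open>*\<close> on the type of matrices is entrywise.
\<close>

definition E_mat :: "nat \<Rightarrow> 'n::finite cmat" where
  "E_mat i = foldr (**)
     (map (\<lambda>j. mscale (1 / (theta TYPE('n) i - theta TYPE('n) j))
                       (adj_mat - mat (theta TYPE('n) j)))
       (filter (\<lambda>j. j \<noteq> i) [0..<Suc CARD('n)]))
     (mat 1)"

definition E_dual :: "nat \<Rightarrow> 'n::finite cmat" where
  "E_dual i = (\<chi> y z. if y = z \<and> cube_dist base_vertex y = i then 1 else 0)"

definition P1 :: "bool \<Rightarrow> bool \<Rightarrow> complex" where
  "P1 a b = (if a then (if b then \<i> else - \<i>) else 1)"

definition P_mat :: "'n::finite cmat" where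
  "P_mat = (\<chi> y z. \<Prod>k\<in>UNIV. P1 (y $ k) (z $ k))"

definition E_eps :: "nat \<Rightarrow> 'n::finite cmat" where
  "E_eps i = matrix_inv P_mat ** E_mat i ** P_mat"

definition mimage :: "complex ^ 'a ^ 'b \<Rightarrow> (complex ^ 'a) set \<Rightarrow> (complex ^ 'b) set" where
  "mimage B W = (\<lambda>v. B *v v) ` W"

definition T_module :: "('n::finite cvec) set \<Rightarrow> bool" where
  "T_module W \<longleftrightarrow> vec.subspace W \<and> (\<forall>B\<in>T_alg. mimage B W \<subseteq> W)"

definition irreducible_T_module :: "('n::finite cvec) set \<Rightarrow> bool" where
  "irreducible_T_module W \<longleftrightarrow> T_module W \<and> W \<noteq> {0} \<and>
     (\<forall>U. T_module U \<and> U \<subseteq> W \<longrightarrow> U = {0} \<or> U = W)"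

definition dual_support :: "('n::finite cvec) set \<Rightarrow> nat set" where
  "dual_support W = {i. i \<le> CARD('n) \<and> mimage (E_dual i) W \<noteq> {0}}"

definition endpoint :: "('n::finite cvec) set \<Rightarrow> nat" where
  "endpoint W = Min (dual_support W)"

definition diameter_T :: "('n::finite cvec) set \<Rightarrow> nat" where
  "diameter_T W = card (dual_support W) - 1"

text \<open>
  \<open>hyp2F1_two d i j\<close> is the value at $2$ of the ${}_2F_1$ series with upper parameters
  $-i$, $-j$ and lower parameter $-d$. For $i, j \le d$ the summation up to \<open>d\<close> keeps
  all nonzero terms while avoiding the zeros of $(-d)_m$ for $m > d$.
\<close>

definition hyp2F1_two :: "nat \<Rightarrow> nat \<Rightarrow> nat \<Rightarrow> complex" where
  "hyp2F1_two d i j = (\<Sum>m=0..d. pochhammer (- of_nat i) m * pochhammer (- of_nat j) m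
      / (pochhammer (- of_nat d) m * fact m) * 2 ^ m)"

end

theory Submission
  imports Defs
begin

text \<open>
  Identify $V$ with $(\mathbb{C}^2)^{\otimes D}$. Conjugation by $P = P_1^{\otimes D}$ permutes the three
  families of idempotents cyclically ($P^3$ is a scalar and $P$ is unitary up to a scalar), so
  (ii) and (iii) reduce to (i). The generating functions $\sum_i t^i E_i$ and
  $\sum_j s^j E^{\varepsilon}_j$ are tensor powers of $2 \times 2$ matrices. A $T$-module $W$ is
  invariant under the tensor powers of the unipotent upper triangular matrices, which only lower
  the weight; hence they fix every $v \in E^*_r W$, $r$ being the endpoint. Factoring
  $M = LDU$ gives $\langle M^{\otimes D} v, v\rangle = M_{00}^{D-2r} (\det M)^r \|v\|^2$.
  Applied to the product of the two generating functions, this is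
  $(ts)^r \big((1 + \mathbf{i})(1 + st - \mathbf{i}(s+t))/4\big)^d \|v\|^2$, whose coefficients are the
  stated values. The same identity, applied to $Pv$, shows that the weights of $W$ are exactly
  $r, \dots, D - r$.
\<close>

section \<open>Hamming weight and distance from the base vertex\<close>

definition wt :: "'n::finite vertex \<Rightarrow> nat" where
  "wt y = card {k. y $ k}"

lemma wt_le: "wt (y :: 'n::finite vertex) \<le> CARD('n)"
  unfolding wt_def by (rule card_mono) auto

lemma wt_cube_adj:
  assumes "cube_adj y z" shows "wt z \<le> Suc (wt y)"
proof -
  have "{k. z $ k} \<subseteq> {k. y $ k} \<union> {k. y $ k \<noteq> z $ k}" by auto
  then have "wt z \<le> card ({k. y $ k} \<union> {k. y $ k \<noteq> z $ k})"
    unfolding wt_def by (rule card_mono[rotated]) simp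
  also have "\<dots> \<le> wt y + 1"
    using card_Un_le[of "{k. y $ k}" "{k. y $ k \<noteq> z $ k}"] assms
    unfolding wt_def cube_adj_def by simp
  finally show ?thesis by simp
qed

lemma wt_walk_le: "(cube_adj ^^ m) base_vertex y \<Longrightarrow> wt y \<le> m"
proof (induction m arbitrary: y)
  case 0
  then show ?case by (auto simp: base_vertex_def wt_def)
next
  case (Suc m)
  then obtain z where "(cube_adj ^^ m) base_vertex z" "cube_adj z y" by auto
  with Suc.IH[of z] wt_cube_adj[of z y] show ?case by simp
qed

lemma walk_wt: "wt y = m \<Longrightarrow> (cube_adj ^^ m) base_vertex y"
proof (induction m arbitrary: y)
  case 0
  then show ?case by (simp add: wt_def base_vertex_def vec_eq_iff)
next
  case (Suc m)
  then obtain k where k: "y $ k" unfolding wt_def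
    by (metis (mono_tags, lifting) card.empty empty_Collect_eq nat.distinct(1))
  define z where "z = (\<chi> l. y $ l \<and> l \<noteq> k)"
  have "{l. z $ l} = {l. y $ l} - {k}" by (auto simp: z_def)
  then have "wt z = m" using Suc.prems k unfolding wt_def by simp
  moreover have "{l. z $ l \<noteq> y $ l} = {k}" using k by (auto simp: z_def)
  then have "cube_adj z y" unfolding cube_adj_def by simp
  ultimately show ?case using Suc.IH[of z] by auto
qed

lemma cube_dist_base: "cube_dist base_vertex y = wt y"
  unfolding cube_dist_def
  by (rule Least_equality) (auto intro: walk_wt wt_walk_le)

section \<open>Tensor powers of 2-by-2 matrices\<close>

text \<open>The factors are functions of two Booleans rather than matrices, so an identity between
  2-by-2 matrices is settled by four cases.\<close>

definition kron :: "(bool \<Rightarrow> bool \<Rightarrow> complex) \<Rightarrow> 'n::finite cmat" where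
  "kron M = (\<chi> y z. \<Prod>k\<in>UNIV. M (y $ k) (z $ k))"

definition mul2 :: "(bool \<Rightarrow> bool \<Rightarrow> complex) \<Rightarrow> (bool \<Rightarrow> bool \<Rightarrow> complex) \<Rightarrow> bool \<Rightarrow> bool \<Rightarrow> complex"
    (infixl "\<odot>" 70) where
  "mul2 M N a b = M a False * N False b + M a True * N True b"

definition adj2 :: "(bool \<Rightarrow> bool \<Rightarrow> complex) \<Rightarrow> bool \<Rightarrow> bool \<Rightarrow> complex" where
  "adj2 M a b = cnj (M b a)"

definition diag2 :: "complex \<Rightarrow> complex \<Rightarrow> bool \<Rightarrow> bool \<Rightarrow> complex" where
  "diag2 p q a b = (if a = b then if a then q else p else 0)"

text \<open>Unipotent upper triangular, with \<open>False\<close> as the first index. The free entry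
  sits in row \<open>False\<close>, column \<open>True\<close>, so the Kronecker power can only turn
  ones of a vertex into zeros.\<close>

definition upper2 :: "complex \<Rightarrow> bool \<Rightarrow> bool \<Rightarrow> complex" where
  "upper2 c a b = (if a = b then 1 else if b then c else 0)"

text \<open>The inverse of \<open>P1\<close>, which is half of its conjugate transpose.\<close>

definition P1i :: "bool \<Rightarrow> bool \<Rightarrow> complex" where
  "P1i a b = (if b then (if a then - \<i> / 2 else \<i> / 2) else 1 / 2)"

lemma P_mat_kron: "P_mat = kron P1"
  unfolding P_mat_def kron_def ..

text \<open>Distributivity of a product over sums, indexed by vectors. It lets products of Kronecker
  powers factor coordinate by coordinate, as \<open>kron_mult\<close> needs.\<close>

lemma sum_vec_prod:
  fixes f :: "'n::finite \<Rightarrow> 'a::finite \<Rightarrow> complex"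
  shows "(\<Sum>w\<in>(UNIV :: ('a ^ 'n) set). \<Prod>k\<in>UNIV. f k (w $ k)) = (\<Prod>k\<in>UNIV. \<Sum>c\<in>UNIV. f k c)"
proof -
  have "(\<Prod>k\<in>UNIV. \<Sum>c\<in>UNIV. f k c) = (\<Sum>g\<in>UNIV. \<Prod>k\<in>UNIV. f k (g k))"
    by (subst prod_sum_PiE) (auto simp: PiE_UNIV_domain)
  also have "\<dots> = (\<Sum>w\<in>(UNIV :: ('a ^ 'n) set). \<Prod>k\<in>UNIV. f k (w $ k))"
    by (rule sum.reindex_bij_witness[of _ "vec_nth" "vec_lambda"]) auto
  finally show ?thesis by simp
qed

lemma kron_mult: "kron M ** kron N = (kron (M \<odot> N) :: 'n::finite cmat)"
proof -
  have "(\<Sum>w\<in>UNIV. (\<Prod>k\<in>UNIV. M (y $ k) (w $ k)) * (\<Prod>k\<in>UNIV. N (w $ k) (z $ k)))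
      = (\<Prod>k\<in>UNIV. (M \<odot> N) (y $ k) (z $ k))" for y z :: "'n vertex"
    unfolding prod.distrib[symmetric]
    by (subst sum_vec_prod) (simp add: mul2_def UNIV_bool)
  then show ?thesis unfolding kron_def matrix_matrix_mult_def by (simp add: vec_eq_iff)
qed

lemma kron_kron: "kron M *v (kron N *v v) = kron (M \<odot> N) *v v"
  by (simp add: matrix_vector_mul_assoc kron_mult)

lemma kron_diag:
  fixes v :: "'n::finite cvec"
  shows "(kron (diag2 p q) *v v) $ y = p ^ (CARD('n) - wt y) * q ^ wt y * v $ y"
proof -
  have off: "(\<Prod>k\<in>UNIV. diag2 p q (y $ k) (z $ k)) = 0" if "z \<noteq> y" for z
    using that by (subst prod_zero_iff) (auto simp: diag2_def vec_eq_iff)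
  have "(\<Prod>k\<in>UNIV. diag2 p q (y $ k) (y $ k)) = (\<Prod>k\<in>UNIV. if y $ k then q else p)"
    by (simp add: diag2_def)
  also have "\<dots> = q ^ wt y * p ^ card {k. \<not> y $ k}"
    by (simp add: prod.If_cases wt_def Collect_neg_eq)
  also have "card {k. \<not> y $ k} = CARD('n) - wt y"
    unfolding wt_def Collect_neg_eq by (simp add: Compl_eq_Diff_UNIV card_Diff_subset)
  finally have on: "(\<Prod>k\<in>UNIV. diag2 p q (y $ k) (y $ k)) = p ^ (CARD('n) - wt y) * q ^ wt y"
    by simp
  have "(kron (diag2 p q) *v v) $ y
      = (\<Sum>z\<in>UNIV. (\<Prod>k\<in>UNIV. diag2 p q (y $ k) (z $ k)) * v $ z)"
    by (simp add: kron_def matrix_vector_mult_def)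
  also have "\<dots> = (\<Sum>z\<in>UNIV. if z = y then p ^ (CARD('n) - wt y) * q ^ wt y * v $ y else 0)"
    by (rule sum.cong) (auto simp: off on)
  finally show ?thesis by simp
qed

lemma kron_scalar: "kron (diag2 c c) *v v = c ^ CARD('n) *s (v :: 'n::finite cvec)"
  by (simp add: vec_eq_iff kron_diag power_add[symmetric] wt_le)

lemma kron_id: "kron (diag2 1 1) *v v = v"
  by (simp add: kron_scalar)

lemma herm_kron: "herm (kron M *v v) w = herm v (kron (adj2 M) *v w)"
  unfolding herm_def kron_def matrix_vector_mult_def adj2_def
  by (simp add: sum_distrib_left sum_distrib_right, subst sum.swap, simp add: mult_ac)

lemma herm_scale: "herm (a *s v) (b *s w) = a * cnj b * herm v w"
  unfolding herm_def by (simp add: sum_distrib_left mult_ac)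

lemma herm_sum:
  "herm (\<Sum>i\<in>I. a i *s x i) (\<Sum>j\<in>J. b j *s z j)
    = (\<Sum>i\<in>I. \<Sum>j\<in>J. a i * cnj (b j) * herm (x i) (z j))"
proof -
  have *: "herm (\<Sum>i\<in>I. f i) w = (\<Sum>i\<in>I. herm (f i) w)" for f :: "'b \<Rightarrow> complex ^ 'a" and w I
    unfolding herm_def sum_component sum_distrib_right by (rule sum.swap)
  have **: "herm w (\<Sum>j\<in>J. f j) = (\<Sum>j\<in>J. herm w (f j))" for f :: "'c \<Rightarrow> complex ^ 'a" and w J
    unfolding herm_def sum_component cnj_sum sum_distrib_left by (rule sum.swap)
  show ?thesis unfolding * ** herm_scale by (rule sum.swap)
qed

section \<open>The three families of idempotents\<close>

text \<open>A Lagrange basis polynomial evaluated at a matrix \<open>B\<close> that is left open, so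
  that \<open>E_mat\<close> and \<open>E_dual\<close> come from the same polynomial at
  \<open>adj_mat\<close> and \<open>dual_adj_mat\<close>.\<close>

definition lagrange_mat :: "'n::finite cmat \<Rightarrow> nat \<Rightarrow> 'n cmat" where
  "lagrange_mat B i = foldr (**)
     (map (\<lambda>j. mscale (1 / (theta TYPE('n) i - theta TYPE('n) j)) (B - mat (theta TYPE('n) j)))
       (filter (\<lambda>j. j \<noteq> i) [0..<Suc CARD('n)])) (mat 1)"

lemma E_mat_lagrange: "E_mat i = lagrange_mat adj_mat i"
  unfolding E_mat_def lagrange_mat_def ..

lemma mscale_vec: "mscale c M *v v = c *s (M *v v)"
  unfolding mscale_def matrix_vector_mult_def by (simp add: vec_eq_iff sum_distrib_left mult_ac)

lemma mat_vec: "mat c *v v = c *s (v :: complex ^ 'a)"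
proof -
  have "(\<Sum>j\<in>UNIV. (if i = j then c else 0) * v $ j) = (\<Sum>j\<in>UNIV. if i = j then c * v $ j else 0)" for i
    by (rule sum.cong) auto
  then show ?thesis
    unfolding mat_def matrix_vector_mult_def by (simp add: vec_eq_iff)
qed

text \<open>A matrix that intertwines \<open>B\<close> and \<open>C\<close> also intertwines equal
  polynomials in them, one linear factor at a time.\<close>

lemma foldr_vec_intertwine:
  assumes "\<And>v. Q *v (B *v v) = C *v (Q *v v)"
  shows "Q *v (foldr (**) (map (\<lambda>j. mscale (f j) (B - mat (g j))) js) (mat 1) *v v)
    = foldr (**) (map (\<lambda>j. mscale (f j) (C - mat (g j))) js) (mat 1) *v (Q *v (v :: complex ^ 'a))"
proof (induction js)
  case Nil
  then show ?case by simp
next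
  case (Cons j js)
  have "Q *v (mscale (f j) (B - mat (g j)) *v x) = mscale (f j) (C - mat (g j)) *v (Q *v x)" for x
    by (simp add: mscale_vec mat_vec matrix_vector_mult_diff_rdistrib matrix_vector_mult_diff_distrib
        vector_scalar_commute assms)
  with Cons show ?case by (simp add: matrix_vector_mul_assoc[symmetric])
qed

lemma lagrange_mat_intertwine:
  fixes Q :: "'n::finite cmat"
  assumes "\<And>v. Q *v (B *v v) = C *v (Q *v v)"
  shows "Q *v (lagrange_mat B i *v v) = lagrange_mat C i *v (Q *v v)"
  unfolding lagrange_mat_def by (rule foldr_vec_intertwine[OF assms])

text \<open>A subspace stable under \<open>B\<close> is stable under polynomials in
  \<open>B\<close>. This makes T-modules invariant under the idempotents without placing these in
  \<open>T_alg\<close>.\<close>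

lemma lagrange_mat_invariant:
  assumes W: "vec.subspace W" and B: "\<And>w. w \<in> W \<Longrightarrow> B *v w \<in> W" and "w \<in> W"
  shows "lagrange_mat B i *v w \<in> W"
proof -
  have "foldr (**) (map (\<lambda>j. mscale (f j) (B - mat (g j))) js) (mat 1) *v w \<in> W"
    for f g :: "nat \<Rightarrow> complex" and js
    using \<open>w \<in> W\<close>
    by (induction js)
      (simp_all add: matrix_vector_mul_assoc[symmetric] mscale_vec mat_vec
        matrix_vector_mult_diff_rdistrib B vec.subspace_scale[OF W] vec.subspace_diff[OF W])
  then show ?thesis unfolding lagrange_mat_def .
qed

lemma E_dual_vec: "(E_dual i *v v) $ y = (if wt y = i then v $ y else 0)"
proof -
  have "(\<Sum>j\<in>UNIV. (if y = j \<and> wt y = i then 1 else 0) * v $ j)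
      = (\<Sum>j\<in>UNIV. if y = j then if wt y = i then v $ j else 0 else 0)"
    by (rule sum.cong) auto
  then show ?thesis
    by (simp add: E_dual_def matrix_vector_mult_def cube_dist_base)
qed

lemma dual_adj_vec:
  fixes v :: "'n::finite cvec"
  shows "(dual_adj_mat *v v) $ y = theta TYPE('n) (wt y) * v $ y"
proof -
  have "(\<Sum>j\<in>UNIV. (if y = j then c else 0) * v $ j) = (\<Sum>j\<in>UNIV. if y = j then c * v $ j else 0)"
    for c
    by (rule sum.cong) auto
  then show ?thesis
    by (simp add: dual_adj_mat_def matrix_vector_mult_def cube_dist_base theta_def)
qed

lemma theta_eq_iff: "theta TYPE('n::finite) i = theta TYPE('n) j \<longleftrightarrow> i = j"
  by (simp add: theta_def)

text \<open>Since \<open>dual_adj_mat\<close> is diagonal, the product acts at \<open>y\<close> by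
  the Lagrange basis polynomial at the eigenvalue of index \<open>wt y\<close>: every factor is 1 if
  this index is \<open>i\<close>, and otherwise some factor vanishes.\<close>

lemma E_dual_lagrange:
  assumes "i \<le> CARD('n::finite)"
  shows "(E_dual i :: 'n cmat) *v v = lagrange_mat dual_adj_mat i *v v"
proof -
  have *: "(foldr (**) (map (\<lambda>j. mscale (f j) (dual_adj_mat - mat (g j))) js) (mat 1) *v v) $ y
      = (\<Prod>j\<leftarrow>js. f j * (theta TYPE('n) (wt y) - g j)) * v $ y"
    for f g :: "nat \<Rightarrow> complex" and js y
    by (induction js)
      (simp_all add: matrix_vector_mul_assoc[symmetric] mscale_vec mat_vec
        matrix_vector_mult_diff_rdistrib dual_adj_vec algebra_simps)
  have "(\<Prod>j\<leftarrow>filter (\<lambda>j. j \<noteq> i) [0..<Suc CARD('n)]. 1 / (theta TYPE('n) i - theta TYPE('n) j) *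
       (theta TYPE('n) (wt y) - theta TYPE('n) j)) = (if wt y = i then 1 else 0)" for y :: "'n vertex"
  proof (cases "wt y = i")
    case True
    have "(\<Prod>j\<leftarrow>js. 1 / (theta TYPE('n) i - theta TYPE('n) j) *
       (theta TYPE('n) i - theta TYPE('n) j)) = 1" if "i \<notin> set js" for js
      using that by (induction js) (auto simp: theta_eq_iff)
    from this[of "filter (\<lambda>j. j \<noteq> i) [0..<Suc CARD('n)]"] True show ?thesis by simp
  next
    case False
    with wt_le[of y] have "wt y \<in> set (filter (\<lambda>j. j \<noteq> i) [0..<Suc CARD('n)])"
      by (simp add: less_Suc_eq_le del: upt_Suc)
    then show ?thesis using False
      by (subst if_not_P) (force simp: prod_list_zero_iff simp del: upt_Suc)+
  qed
  then show ?thesis by (simp add: vec_eq_iff lagrange_mat_def * E_dual_vec del: upt_Suc)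
qed

section \<open>Diagonalisation of the adjacency matrix by the Kronecker power of
  \<open>P1\<close>\<close>

lemma kron_P1_adj: "kron P1 ** adj_mat = dual_adj_mat ** (kron P1 :: 'n::finite cmat)"
proof -
  have "(\<Sum>y\<in>UNIV. (\<Prod>k\<in>UNIV. P1 (x $ k) (y $ k)) * (if cube_adj y z then 1 else 0))
      = theta TYPE('n) (wt x) * (\<Prod>k\<in>UNIV. P1 (x $ k) (z $ k))" for x z :: "'n vertex"
  proof -
    define flip where "flip k = (\<chi> l. if l = k then \<not> z $ l else z $ l)" for k :: 'n
    define p where "p y = (\<Prod>k\<in>UNIV. P1 (x $ k) (y $ k))" for y :: "'n vertex"
    have differ: "{l. flip k $ l \<noteq> z $ l} = {k}" for k by (auto simp: flip_def)
    have "inj flip"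
      by (rule injI) (metis differ singleton_inject)
    have nbrs: "{y. cube_adj y z} = range flip"
    proof (intro set_eqI iffI)
      fix y assume "y \<in> {y. cube_adj y z}"
      then obtain k where k: "{l. y $ l \<noteq> z $ l} = {k}"
        unfolding cube_adj_def by (auto simp: card_1_singleton_iff)
      have "y = flip k" unfolding vec_eq_iff
      proof
        fix l show "y $ l = flip k $ l" using k by (cases "l = k") (auto simp: flip_def)
      qed
      then show "y \<in> range flip" by simp
    next
      fix y assume "y \<in> range flip"
      then show "y \<in> {y. cube_adj y z}" using differ by (auto simp: cube_adj_def simp del: not_iff)
    qed
    \<comment> \<open>Row \<open>x\<close> of the Kronecker power behaves like a character: flipping
      coordinate \<open>k\<close> changes the sign exactly when \<open>x $ k\<close>. The signs
      summed over all \<open>k\<close> give D - 2 \<open>wt x\<close>.\<close>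
    have p_flip: "p (flip k) = (if x $ k then -1 else 1) * p z" for k
    proof -
      have "p (flip k) = P1 (x $ k) (\<not> z $ k) * (\<Prod>l\<in>UNIV - {k}. P1 (x $ l) (flip k $ l))"
        unfolding p_def by (subst prod.remove[of _ k]) (auto simp: flip_def)
      also have "(\<Prod>l\<in>UNIV - {k}. P1 (x $ l) (flip k $ l)) = (\<Prod>l\<in>UNIV - {k}. P1 (x $ l) (z $ l))"
        by (rule prod.cong) (auto simp: flip_def)
      also have "P1 (x $ k) (\<not> z $ k) = (if x $ k then -1 else 1) * P1 (x $ k) (z $ k)"
        by (simp add: P1_def)
      finally show ?thesis
        unfolding p_def by (subst (2) prod.remove[of _ k]) auto
    qed
    have "(\<Sum>y\<in>UNIV. p y * (if cube_adj y z then 1 else 0)) = (\<Sum>y\<in>range flip. p y)"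
      unfolding nbrs[symmetric] by (simp add: if_distrib[of "(*) _"] sum.If_cases cong: if_cong)
    also have "\<dots> = (\<Sum>k\<in>UNIV. p (flip k))"
      using \<open>inj flip\<close> by (simp add: sum.reindex)
    also have "\<dots> = (\<Sum>k\<in>UNIV. 1 - 2 * of_bool (x $ k)) * p z"
      unfolding sum_distrib_right by (rule sum.cong) (auto simp: p_flip)
    also have "(\<Sum>k\<in>UNIV. 1 - 2 * of_bool (x $ k)) = theta TYPE('n) (wt x)"
      by (simp add: sum_subtractf sum_distrib_left[symmetric] theta_def wt_def)
    finally show ?thesis unfolding p_def .
  qed
  moreover have "(dual_adj_mat ** (kron P1 :: 'n cmat)) $ x $ z
      = theta TYPE('n) (wt x) * (\<Prod>k\<in>UNIV. P1 (x $ k) (z $ k))" for x z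
  proof -
    have "(\<Sum>j\<in>UNIV. (if x = j then c else 0) * g j) = (\<Sum>j\<in>UNIV. if x = j then c * g j else 0)"
      for c and g :: "'n vertex \<Rightarrow> complex"
      by (rule sum.cong) auto
    then show ?thesis
      by (simp add: dual_adj_mat_def matrix_matrix_mult_def cube_dist_base theta_def kron_def)
  qed
  ultimately show ?thesis
    by (simp add: vec_eq_iff) (simp add: matrix_matrix_mult_def kron_def adj_mat_def)
qed

lemmas mat2_defs = mul2_def adj2_def diag2_def upper2_def P1_def P1i_def

lemma P1i_P1: "P1i \<odot> P1 = diag2 1 1" "P1 \<odot> P1i = diag2 1 1"
  by (intro ext; auto simp: mat2_defs complex_eq_iff)+

lemma kron_P1_inverse: "kron P1i *v (kron P1 *v v) = v" "kron P1 *v (kron P1i *v v) = v"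
  by (simp_all add: kron_kron P1i_P1 kron_id)

lemma matrix_inv_P: "matrix_inv P_mat *v v = kron P1i *v (v :: 'n::finite cvec)"
proof -
  have "kron P1i ** kron P1 = (mat 1 :: 'n cmat)" "kron P1 ** kron P1i = (mat 1 :: 'n cmat)"
    by (simp_all add: matrix_eq kron_P1_inverse flip: matrix_vector_mul_assoc)
  then have "invertible (P_mat :: 'n cmat)"
    unfolding invertible_def P_mat_kron by blast
  then have "matrix_inv P_mat ** P_mat = (mat 1 :: 'n cmat)"
    unfolding invertible_def matrix_inv_def by (rule someI2_ex) blast
  then have "matrix_inv P_mat *v (kron P1 *v (kron P1i *v v)) = kron P1i *v v"
    by (simp add: P_mat_kron matrix_vector_mul_assoc matrix_mul_assoc)
  then show ?thesis by (simp add: kron_P1_inverse)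
qed

lemma E_mat_conj:
  assumes "i \<le> CARD('n::finite)"
  shows "E_mat i *v v = kron P1i *v (E_dual i *v (kron P1 *v (v :: 'n cvec)))"
proof -
  have "kron P1 *v (E_mat i *v v) = E_dual i *v (kron P1 *v v)"
    unfolding E_mat_lagrange E_dual_lagrange[OF assms]
    by (rule lagrange_mat_intertwine) (simp add: matrix_vector_mul_assoc kron_P1_adj)
  then show ?thesis by (metis kron_P1_inverse(1))
qed

lemma E_eps_conj: "E_eps i *v v = kron P1i *v (E_mat i *v (kron P1 *v v))"
  by (simp add: E_eps_def matrix_vector_mul_assoc[symmetric] matrix_inv_P) (simp add: P_mat_kron)

section \<open>Generating functions of the three families of idempotents\<close>

lemma sum_E_dual:
  fixes v :: "'n::finite cvec"
  shows "(\<Sum>i\<le>CARD('n). t ^ i *s (E_dual i *v v)) = kron (diag2 1 t) *v v"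
  by (simp add: vec_eq_iff sum_component kron_diag E_dual_vec if_distrib wt_le cong: if_cong)

lemma kron_sum: "(\<Sum>i\<in>I. a i *s (kron M *v x i)) = kron M *v (\<Sum>i\<in>I. a i *s x i)"
  by (induction I rule: infinite_finite_induct)
    (simp_all add: matrix_vector_right_distrib vector_scalar_commute)

lemma sum_E_mat:
  fixes v :: "'n::finite cvec"
  shows "(\<Sum>i\<le>CARD('n). t ^ i *s (E_mat i *v v)) = kron (P1i \<odot> diag2 1 t \<odot> P1) *v v"
  by (simp add: E_mat_conj kron_sum sum_E_dual kron_kron[symmetric])

lemma sum_E_eps:
  fixes v :: "'n::finite cvec"
  shows "(\<Sum>i\<le>CARD('n). t ^ i *s (E_eps i *v v))
    = kron (P1i \<odot> (P1i \<odot> diag2 1 t \<odot> P1) \<odot> P1) *v v"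
  by (simp add: E_eps_conj kron_sum sum_E_mat kron_kron[symmetric])

section \<open>Invariance of T-modules under tensor powers\<close>

definition keeps :: "(complex ^ 'a) set \<Rightarrow> complex ^ 'a ^ 'a \<Rightarrow> bool" where
  "keeps W B \<longleftrightarrow> (\<forall>w\<in>W. B *v w \<in> W)"

lemma keepsD: "keeps W B \<Longrightarrow> w \<in> W \<Longrightarrow> B *v w \<in> W"
  unfolding keeps_def by blast

lemma keeps_kron_mul: "keeps W (kron M) \<Longrightarrow> keeps W (kron N) \<Longrightarrow> keeps W (kron (M \<odot> N))"
  unfolding keeps_def kron_kron[symmetric] by blast

locale T_invariant =
  fixes W :: "('n::finite cvec) set"
  assumes T_module: "T_module W"
begin

lemma subspace: "vec.subspace W"
  using T_module unfolding T_module_def by blast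

lemma keeps_T: "B \<in> T_alg \<Longrightarrow> keeps W B"
  using T_module unfolding T_module_def keeps_def mimage_def by blast

lemma keeps_E_dual: "keeps W (E_dual i)"
proof (cases "i \<le> CARD('n)")
  case True
  then show ?thesis
    using lagrange_mat_invariant[OF subspace keepsD[OF keeps_T[OF T_alg.dual_adj]]]
    unfolding keeps_def by (simp add: E_dual_lagrange)
next
  case False
  then have "E_dual i *v (v :: 'n cvec) = 0" for v
    using wt_le by (auto simp: vec_eq_iff E_dual_vec)
  then show ?thesis unfolding keeps_def using vec.subspace_0[OF subspace] by simp
qed

lemma keeps_E_mat: "keeps W (E_mat i)"
  using lagrange_mat_invariant[OF subspace keepsD[OF keeps_T[OF T_alg.adj]]]
  unfolding keeps_def by (simp add: E_mat_lagrange)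

lemma keeps_diag:
  assumes "p \<noteq> 0" shows "keeps W (kron (diag2 p q))"
proof -
  have 1: "keeps W (kron (diag2 1 t))" for t
    unfolding keeps_def sum_E_dual[symmetric]
    by (intro ballI vec.subspace_sum[OF subspace] vec.subspace_scale[OF subspace] keepsD[OF keeps_E_dual])
  have 2: "keeps W (kron (diag2 p p))"
    unfolding keeps_def kron_scalar using vec.subspace_scale[OF subspace] by blast
  \<comment> \<open>The factor \<open>p\<close> is split off because the generating functions of the
    \<open>E_dual i\<close> only provide the normalised matrices \<open>diag2 1 t\<close>.\<close>
  have "diag2 p q = diag2 p p \<odot> diag2 1 (q / p)"
    using assms by (intro ext) (auto simp: mat2_defs)
  then show ?thesis using keeps_kron_mul[OF 2 1] by simp
qed

text \<open>The 2-by-2 matrices here are the circulants with diagonal (p + q)/2 and off-diagonal (p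
  - q)/2. Up to the scalar \<open>p\<close> they come from the generating function of the
  \<open>E_mat i\<close>.\<close>

lemma keeps_circ:
  assumes "p \<noteq> 0" shows "keeps W (kron (P1i \<odot> diag2 p q \<odot> P1))"
proof -
  have 1: "keeps W (kron (P1i \<odot> diag2 1 t \<odot> P1))" for t
    unfolding keeps_def sum_E_mat[symmetric]
    by (intro ballI vec.subspace_sum[OF subspace] vec.subspace_scale[OF subspace] keepsD[OF keeps_E_mat])
  have "P1i \<odot> diag2 p q \<odot> P1 = diag2 p p \<odot> (P1i \<odot> diag2 1 (q / p) \<odot> P1)"
    using assms by (intro ext) (auto simp: mat2_defs field_simps)
  then show ?thesis using keeps_kron_mul[OF keeps_diag[OF assms] 1] by simp
qed

lemma keeps_P1: "keeps W (kron P1)"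
proof -
  \<comment> \<open>The circulant in the middle has diagonal entries 1 and off-diagonal entries
    \<open>\<i>\<close>; the outer diagonal matrices correct the phases to those of
    \<open>P1\<close>.\<close>
  have "P1 = diag2 1 (-1) \<odot> (P1i \<odot> diag2 (1 + \<i>) (1 - \<i>) \<odot> P1) \<odot> diag2 1 (- \<i>)"
    by (intro ext) (auto simp: mat2_defs complex_eq_iff)
  moreover have "1 + \<i> \<noteq> 0" by (simp add: complex_eq_iff)
  then have "keeps W (kron (diag2 1 (-1) \<odot> (P1i \<odot> diag2 (1 + \<i>) (1 - \<i>) \<odot> P1) \<odot> diag2 1 (- \<i>)))"
    by (intro keeps_kron_mul[of W _ "diag2 1 (- \<i>)"] keeps_kron_mul[of W "diag2 1 (-1)"]
        keeps_diag keeps_circ) simp_all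
  ultimately show ?thesis by (rule ssubst[where P = "\<lambda>M. keeps W (kron M)"])
qed

lemma keeps_upper: "keeps W (kron (upper2 b))"
proof (cases "b = 0")
  case True
  then have "upper2 b = diag2 1 1" by (intro ext) (auto simp: mat2_defs)
  then show ?thesis by (simp add: keeps_diag)
next
  case False
  \<comment> \<open>Two circulants around a diagonal matrix can cancel the lower left entry, leaving a multiple
    of \<open>upper2 (5 / 16)\<close> up to a diagonal factor; conjugating by a diagonal matrix rescales
    $5/16$ to $b$.\<close>
  let ?N = "diag2 1 (5 / (16 * b)) \<odot> ((P1i \<odot> diag2 3 (-1) \<odot> P1) \<odot> (diag2 1 (-2/3)
      \<odot> ((P1i \<odot> diag2 4 (-2) \<odot> P1) \<odot> diag2 (-1/3) (3 * b / 5))))"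
  have "?N x y = upper2 b x y" for x y
    using False by (cases x; cases y) (simp_all add: mat2_defs)
  then have "?N = upper2 b" by (intro ext)
  moreover have "keeps W (kron ?N)"
    by (intro keeps_kron_mul[of W "diag2 _ _"] keeps_kron_mul[of W "P1i \<odot> diag2 _ _ \<odot> P1"]
        keeps_diag keeps_circ) simp_all
  ultimately show ?thesis by (rule subst[where P = "\<lambda>M. keeps W (kron M)"])
qed

text \<open>The swap is the circulant with eigenvalues 1 and -1. It complements vertices, which
  yields the symmetry of the weights of \<open>W\<close> under k to D - k.\<close>

lemma keeps_swap: "keeps W (kron (\<lambda>a b. of_bool (a \<noteq> b)))"
proof -
  have "(\<lambda>a b. of_bool (a \<noteq> b)) = P1i \<odot> diag2 1 (-1) \<odot> P1"
    by (intro ext) (auto simp: mat2_defs)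
  then show ?thesis by (simp add: keeps_circ)
qed

end

section \<open>Vectors of extremal weight\<close>

text \<open>Below weight \<open>r\<close> the image vanishes because it lies in \<open>W\<close>.
  From weight \<open>r\<close> on, only diagonal entries of the Kronecker power meet the support of
  \<open>v\<close>.\<close>

lemma kron_upper_fixes:
  assumes W: "T_module W" and "v \<in> W" and supp: "\<And>y. wt y \<noteq> r \<Longrightarrow> v $ y = 0"
    and min: "\<And>k w. k < r \<Longrightarrow> w \<in> W \<Longrightarrow> E_dual k *v w = 0"
  shows "kron (upper2 b) *v v = v"
proof -
  interpret T_invariant W by unfold_locales (fact W)
  have "(kron (upper2 b) *v v) $ y = v $ y" for y
  proof (cases "wt y < r")
    case True
    then have "E_dual (wt y) *v (kron (upper2 b) *v v) = 0"
      using min keepsD[OF keeps_upper \<open>v \<in> W\<close>] by blast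
    then have "(E_dual (wt y) *v (kron (upper2 b) *v v)) $ y = 0" by simp
    with True show ?thesis by (simp add: E_dual_vec supp)
  next
    case False
    \<comment> \<open>A nonzero entry forces the ones of \<open>y\<close> to be among those of
      \<open>z\<close>. Since \<open>z\<close> has weight \<open>r\<close> and \<open>y\<close> at
      least that, the two vertices agree.\<close>
    have off: "(\<Prod>k\<in>UNIV. upper2 b (y $ k) (z $ k)) * v $ z = 0" if "z \<noteq> y" for z
    proof (rule ccontr)
      assume neq: "\<not> ?thesis"
      then have "wt z = r" using supp by auto
      have "{k. y $ k} \<subseteq> {k. z $ k}"
        using neq by (auto simp: upper2_def split: if_splits)
      moreover have "card {k. z $ k} \<le> card {k. y $ k}"
        using False \<open>wt z = r\<close> by (simp add: wt_def)
      ultimately have "{k. y $ k} = {k. z $ k}"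
        by (metis card_seteq finite)
      with that show False by (auto simp: vec_eq_iff)
    qed
    have "(kron (upper2 b) *v v) $ y = (\<Sum>z\<in>UNIV. (\<Prod>k\<in>UNIV. upper2 b (y $ k) (z $ k)) * v $ z)"
      by (simp add: kron_def matrix_vector_mult_def)
    also have "\<dots> = (\<Sum>z\<in>UNIV. if z = y then v $ y else 0)"
      using off by (intro sum.cong) (auto simp: upper2_def)
    finally show ?thesis by simp
  qed
  then show ?thesis by (simp add: vec_eq_iff)
qed

lemma adj2_adj2: "adj2 (adj2 M) = M"
  by (intro ext) (simp add: adj2_def)

lemma herm_kron_highest:
  fixes v :: "'n::finite cvec"
  assumes inv: "\<And>b. kron (upper2 b) *v v = v" and supp: "\<And>y. wt y \<noteq> r \<Longrightarrow> v $ y = 0"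
    and r: "2 * r \<le> CARD('n)" and a: "M False False \<noteq> 0"
  shows "herm (kron M *v v) v = M False False ^ (CARD('n) - 2 * r)
    * (M False False * M True True - M False True * M True False) ^ r * herm v v"
proof -
  define a b c e where entries: "a = M False False" "b = M False True" "c = M True False" "e = M True True"
  define dt where "dt = a * e - b * c"
  have "a \<noteq> 0" using a by (simp add: entries)
  \<comment> \<open>The LDU factorization of \<open>M\<close>. The lower factor is written as an
    adjoint, so that it can move to the second argument of \<open>herm\<close>, where
    \<open>inv\<close> absorbs it.\<close>
  define N where "N = adj2 (upper2 (cnj (c / a))) \<odot> (diag2 a (dt / a) \<odot> upper2 (b / a))"
  have "M x y = N x y" for x y
    using \<open>a \<noteq> 0\<close>
    by (cases x; cases y) (simp_all add: N_def mat2_defs entries[symmetric] dt_def diff_divide_distrib)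
  then have "M = N" by (intro ext)
  then have "herm (kron M *v v) v = herm (kron N *v v) v" by simp
  also have "\<dots> = herm (kron (diag2 a (dt / a)) *v v) v"
    unfolding N_def kron_kron[symmetric] by (simp only: inv herm_kron adj2_adj2)
  also have "kron (diag2 a (dt / a)) *v v = (a ^ (CARD('n) - r) * (dt / a) ^ r) *s v"
    unfolding vec_eq_iff
  proof
    fix y show "(kron (diag2 a (dt / a)) *v v) $ y = ((a ^ (CARD('n) - r) * (dt / a) ^ r) *s v) $ y"
      by (cases "wt y = r") (simp_all add: kron_diag supp)
  qed
  also have "a ^ (CARD('n) - r) * (dt / a) ^ r = a ^ (CARD('n) - 2 * r) * dt ^ r"
  proof -
    have "CARD('n) - r = (CARD('n) - 2 * r) + r" using r by simp
    then have "a ^ (CARD('n) - r) = a ^ (CARD('n) - 2 * r) * a ^ r"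
      by (metis power_add)
    then show ?thesis using \<open>a \<noteq> 0\<close> by (simp only: power_divide) simp
  qed
  also have "herm (\<dots> *s v) v = \<dots> * herm v v"
    using herm_scale[of _ v 1 v] by simp
  finally show ?thesis unfolding dt_def entries .
qed

section \<open>Generating function of the hypergeometric values\<close>

text \<open>For \<open>n \<le> d\<close>, the coefficient of x^i in x^n (1 + x)^(d - n). The case
  split guards against truncated subtraction, which would turn \<open>i - n\<close> into 0 and the
  binomial coefficient into 1 for \<open>i < n\<close>.\<close>

definition shift_binom :: "nat \<Rightarrow> nat \<Rightarrow> nat \<Rightarrow> complex" where
  "shift_binom d n i = (if n \<le> i then of_nat ((d - n) choose (i - n)) else 0)"

text \<open>Up to the common sign (-1)^n, both sides count the \<open>i\<close>-subsets of a
  \<open>d\<close>-set together with an ordered choice of \<open>n\<close> distinct elements of the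
  subset. The induction is by binomial absorption.\<close>

lemma binomial_pochhammer:
  assumes "n \<le> d"
  shows "of_nat (d choose i) * pochhammer (- of_nat i) n
    = (pochhammer (- of_nat d) n * shift_binom d n i :: complex)"
  using assms
proof (induction n)
  case 0
  then show ?case by (simp add: shift_binom_def)
next
  case (Suc n)
  have step: "shift_binom d n i * (of_nat n - of_nat i) = (of_nat n - of_nat d) * shift_binom d (Suc n) i"
  proof (cases "Suc n \<le> i")
    case True
    then have "(i - n) * ((d - n) choose (i - n)) = (d - n) * ((d - Suc n) choose (i - Suc n))"
      using binomial_absorption[of "i - Suc n" "d - n"] by (simp add: Suc_diff_le Suc_diff_Suc)
    then have "(of_nat i - of_nat n) * of_nat ((d - n) choose (i - n))
        = ((of_nat d - of_nat n) * of_nat ((d - Suc n) choose (i - Suc n)) :: complex)"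
      using True Suc.prems by (metis Suc_leD of_nat_diff of_nat_mult)
    then show ?thesis using True by (simp add: shift_binom_def algebra_simps)
  next
    case False
    then show ?thesis by (cases "i = n") (simp_all add: shift_binom_def)
  qed
  have "of_nat (d choose i) * pochhammer (- of_nat i) (Suc n)
      = (of_nat (d choose i) * pochhammer (- of_nat i) n) * (of_nat n - of_nat i :: complex)"
    by (simp add: pochhammer_Suc algebra_simps)
  also have "\<dots> = pochhammer (- of_nat d) n * (shift_binom d n i * (of_nat n - of_nat i))"
    using Suc by simp
  also have "\<dots> = pochhammer (- of_nat d) (Suc n) * shift_binom d (Suc n) i"
    unfolding step by (simp add: pochhammer_Suc algebra_simps)
  finally show ?case .
qed

text \<open>Absorbing each upper Pochhammer symbol into a binomial coefficient separates the
  dependence on \<open>i\<close> from that on \<open>j\<close>, as the generating function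
  requires.\<close>

lemma binomial_hyp2F1:
  "of_nat (d choose i) * of_nat (d choose j) * hyp2F1_two d i j
    = (\<Sum>n\<le>d. (-2) ^ n * of_nat (d choose n) * shift_binom d n i * shift_binom d n j)"
  unfolding hyp2F1_two_def sum_distrib_left atLeast0AtMost
proof (rule sum.cong, rule refl)
  fix n assume "n \<in> {..d}"
  then have n: "n \<le> d" by simp
  define p :: complex where "p = pochhammer (- of_nat d) n"
  have "p \<noteq> 0" using n by (simp add: p_def pochhammer_of_nat_eq_0_iff)
  have choose: "of_nat (d choose n) = (-1) ^ n * p / fact n"
    unfolding p_def binomial_gbinomial gbinomial_pochhammer by simp
  have "of_nat (d choose i) * of_nat (d choose j)
      * (pochhammer (- of_nat i) n * pochhammer (- of_nat j) n / (p * fact n) * 2 ^ n)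
     = (of_nat (d choose i) * pochhammer (- of_nat i) n)
      * (of_nat (d choose j) * pochhammer (- of_nat j) n) / (p * fact n) * 2 ^ n"
    by (simp add: mult_ac)
  also have "\<dots> = p / fact n * shift_binom d n i * shift_binom d n j * 2 ^ n"
    unfolding binomial_pochhammer[OF n] p_def[symmetric] using \<open>p \<noteq> 0\<close> by simp
  also have "\<dots> = (-2) ^ n * of_nat (d choose n) * shift_binom d n i * shift_binom d n j"
    unfolding choose power_minus[of "2 :: complex"] using minus_one_power_iff[of n, where 'a = complex]
    by (simp add: mult_ac)
  finally show "of_nat (d choose i) * of_nat (d choose j)
      * (pochhammer (- of_nat i) n * pochhammer (- of_nat j) n / (pochhammer (- of_nat d) n * fact n) * 2 ^ n)
     = (-2) ^ n * of_nat (d choose n) * shift_binom d n i * shift_binom d n j"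
    unfolding p_def .
qed

text \<open>Pads a sum with zeros to the longer index range of the generating functions, so that
  coefficients can be compared.\<close>

lemma sum_shift_support:
  fixes f :: "nat \<Rightarrow> 'a::comm_monoid_add"
  assumes "r + d \<le> m"
  shows "(\<Sum>i\<le>d. f i) = (\<Sum>i\<le>m. if r \<le> i \<and> i \<le> r + d then f (i - r) else 0)"
proof -
  have "(\<Sum>i\<le>d. f i) = (\<Sum>i\<in>{r..r + d}. f (i - r))"
    by (rule sum.reindex_bij_witness[of _ "\<lambda>i. i - r" "\<lambda>i. i + r"]) auto
  also have "\<dots> = (\<Sum>i\<le>m. if r \<le> i \<and> i \<le> r + d then f (i - r) else 0)"
    using assms by (intro sum.mono_neutral_cong_left) auto
  finally show ?thesis .
qed

lemma shift_binom_sum: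
  assumes "n \<le> d"
  shows "x ^ n * (1 + x) ^ (d - n) = (\<Sum>i\<le>d. shift_binom d n i * x ^ i)"
proof -
  have "x ^ n * (1 + x) ^ (d - n) = (\<Sum>k\<le>d - n. of_nat ((d - n) choose k) * x ^ (k + n))"
    by (subst add.commute, subst binomial_ring) (simp add: sum_distrib_left power_add mult_ac)
  also have "\<dots> = (\<Sum>i\<le>d. shift_binom d n i * x ^ i)"
    using assms by (subst sum_shift_support[of n "d - n" d])
      (auto simp: shift_binom_def intro!: sum.cong)
  finally show ?thesis .
qed

text \<open>Binomial expansion in the two terms -2xy and (1 + x)(1 + y); the powers belonging to
  \<open>x\<close> and to \<open>y\<close> are then expanded separately by
  \<open>shift_binom_sum\<close>.\<close>

lemma hyp2F1_generating:
  "((1 + x) * (1 + y) - 2 * x * y) ^ d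
    = (\<Sum>i\<le>d. \<Sum>j\<le>d. of_nat (d choose i) * of_nat (d choose j) * hyp2F1_two d i j * x ^ i * y ^ j)"
proof -
  have "((1 + x) * (1 + y) - 2 * x * y) ^ d
      = (\<Sum>n\<le>d. of_nat (d choose n) * (-2 * x * y) ^ n * ((1 + x) * (1 + y)) ^ (d - n))"
    by (subst binomial_ring[symmetric]) simp
  also have "\<dots> = (\<Sum>n\<le>d. (-2) ^ n * of_nat (d choose n)
      * (x ^ n * (1 + x) ^ (d - n)) * (y ^ n * (1 + y) ^ (d - n)))"
    by (simp only: power_mult_distrib mult_ac)
  also have "\<dots> = (\<Sum>n\<le>d. \<Sum>i\<le>d. \<Sum>j\<le>d.
      (-2) ^ n * of_nat (d choose n) * shift_binom d n i * shift_binom d n j * x ^ i * y ^ j)"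
    by (rule sum.cong) (simp_all add: shift_binom_sum sum_distrib_left sum_distrib_right mult_ac)
  also have "\<dots> = (\<Sum>i\<le>d. \<Sum>j\<le>d. \<Sum>n\<le>d.
      (-2) ^ n * of_nat (d choose n) * shift_binom d n i * shift_binom d n j * x ^ i * y ^ j)"
    by (subst (2) sum.swap, subst sum.swap, subst (2) sum.swap) (rule sum.swap)
  finally show ?thesis
    unfolding binomial_hyp2F1 by (simp add: sum_distrib_right)
qed

text \<open>The difference polynomial has infinitely many roots. Positive real arguments suit the
  applications: conjugation fixes them, and they keep the corner entry in
  \<open>herm_kron_highest\<close> nonzero.\<close>

lemma coeffs_eq_if_eq_on_pos:
  fixes c h :: "nat \<Rightarrow> complex"
  assumes "\<And>t :: real. t > 0 \<Longrightarrow> (\<Sum>i\<le>n. c i * of_real t ^ i) = (\<Sum>i\<le>n. h i * of_real t ^ i)"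
    and "i \<le> n"
  shows "c i = h i"
proof -
  have "complex_of_real ` {0<..} \<subseteq> {x. (\<Sum>i\<le>n. (c i - h i) * x ^ i) = 0}"
    using assms(1) by (auto simp: left_diff_distrib sum_subtractf)
  moreover have "infinite (complex_of_real ` {0<..})"
    by (simp add: finite_image_iff inj_on_def infinite_Ioi)
  ultimately have "infinite {x. (\<Sum>i\<le>n. (c i - h i) * x ^ i) = 0}"
    using finite_subset by blast
  with \<open>i \<le> n\<close> show ?thesis
    using polyfun_finite_roots[of "\<lambda>i. c i - h i" n] by auto
qed

lemma coeffs2_eq_if_eq_on_pos:
  fixes c h :: "nat \<Rightarrow> nat \<Rightarrow> complex"
  assumes "\<And>t s :: real. t > 0 \<Longrightarrow> s > 0 \<Longrightarrow>
      (\<Sum>i\<le>m. \<Sum>j\<le>n. c i j * of_real t ^ i * of_real s ^ j)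
    = (\<Sum>i\<le>m. \<Sum>j\<le>n. h i j * of_real t ^ i * of_real s ^ j)"
    and "i \<le> m" "j \<le> n"
  shows "c i j = h i j"
proof (rule coeffs_eq_if_eq_on_pos[where n = n and c = "c i" and h = "h i"])
  fix s :: real assume "s > 0"
  show "(\<Sum>j\<le>n. c i j * of_real s ^ j) = (\<Sum>j\<le>n. h i j * of_real s ^ j)"
  proof (rule coeffs_eq_if_eq_on_pos[where n = m and i = i])
    fix t :: real assume "t > 0"
    have "(\<Sum>i\<le>m. (\<Sum>j\<le>n. f i j * of_real s ^ j) * of_real t ^ i)
        = (\<Sum>i\<le>m. \<Sum>j\<le>n. f i j * of_real t ^ i * of_real s ^ j)" for f :: "nat \<Rightarrow> nat \<Rightarrow> complex"
      by (simp add: sum_distrib_left sum_distrib_right mult_ac)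
    then show "(\<Sum>i\<le>m. (\<Sum>j\<le>n. c i j * of_real s ^ j) * of_real t ^ i)
        = (\<Sum>i\<le>m. (\<Sum>j\<le>n. h i j * of_real s ^ j) * of_real t ^ i)"
      using assms(1)[OF \<open>t > 0\<close> \<open>s > 0\<close>] by simp
  qed fact
qed fact

section \<open>Inner products of projections of an extremal vector\<close>

lemma mat2_E_mat:
  "P1i \<odot> diag2 1 t \<odot> P1 = (\<lambda>a b. if a = b then (1 + t) / 2 else (1 - t) / 2)"
  by (intro ext) (auto simp: mat2_defs field_simps)

lemma mat2_E_eps:
  "P1i \<odot> (P1i \<odot> diag2 1 t \<odot> P1) \<odot> P1
    = (\<lambda>a b. if a = b then (1 + t) / 2 else if a then - \<i> * (1 - t) / 2 else \<i> * (1 - t) / 2)"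
  unfolding mat2_E_mat by (intro ext) (auto simp: mat2_defs field_simps)

lemma herm_E_highest:
  fixes v :: "'n::finite cvec"
  assumes inv: "\<And>b. kron (upper2 b) *v v = v" and supp: "\<And>y. wt y \<noteq> r \<Longrightarrow> v $ y = 0"
    and D: "CARD('n) = d + 2 * r" and "i \<le> d" "j \<le> d"
  shows "herm (E_mat (r + i) *v v) (E_eps (r + j) *v v)
    = (- \<i>) ^ i * (- \<i>) ^ j * ((1 + \<i>) / 4) ^ d * herm v v
      * of_nat (d choose i) * of_nat (d choose j) * hyp2F1_two d i j"
proof -
  define g where "g i j = of_nat (d choose i) * of_nat (d choose j) * hyp2F1_two d i j" for i j
  define K where "K i j = (- \<i>) ^ i * (- \<i>) ^ j * ((1 + \<i>) / 4) ^ d * herm v v * g i j" for i j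
  define h where "h i j = (if r \<le> i \<and> i \<le> r + d then if r \<le> j \<and> j \<le> r + d
    then K (i - r) (j - r) else 0 else 0)" for i j
  have "herm (E_mat (r + i) *v v) (E_eps (r + j) *v v) = h (r + i) (r + j)"
  proof (rule coeffs2_eq_if_eq_on_pos[where m = "CARD('n)" and n = "CARD('n)"
        and c = "\<lambda>i j. herm (E_mat i *v v) (E_eps j *v v)"])
    fix t s :: real assume pos: "t > 0" "s > 0"
    \<comment> \<open>The product of the two generating functions. The one for \<open>E_eps\<close>
      comes from the second argument of \<open>herm\<close> and hence enters as an adjoint.\<close>
    define M where "M = adj2 (P1i \<odot> (P1i \<odot> diag2 1 (of_real s) \<odot> P1) \<odot> P1)
      \<odot> (P1i \<odot> diag2 1 (of_real t) \<odot> P1)"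
    have a: "M False False = (1 + \<i>) / 4 * (1 + of_real s * of_real t - \<i> * (of_real s + of_real t))"
      unfolding M_def mat2_E_eps unfolding mat2_E_mat by (simp add: mul2_def adj2_def complex_eq_iff field_simps)
    have det: "M False False * M True True - M False True * M True False = of_real t * of_real s"
      unfolding M_def mat2_E_eps unfolding mat2_E_mat by (simp add: mul2_def adj2_def complex_eq_iff field_simps)
    have "Re (M False False) = (1 + s * t + s + t) / 4"
      unfolding a by (simp add: field_simps)
    also have "\<dots> > 0" using pos by (simp add: add_pos_pos)
    finally have "M False False \<noteq> 0" by auto
    have "(\<Sum>i\<le>CARD('n). \<Sum>j\<le>CARD('n). herm (E_mat i *v v) (E_eps j *v v) * of_real t ^ i * of_real s ^ j)
        = herm (\<Sum>i\<le>CARD('n). of_real t ^ i *s (E_mat i *v v)) (\<Sum>j\<le>CARD('n). of_real s ^ j *s (E_eps j *v v))"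
      unfolding herm_sum by (simp add: mult_ac)
    also have "\<dots> = herm (kron M *v v) v"
      unfolding sum_E_mat sum_E_eps M_def kron_kron[symmetric] herm_kron[of "adj2 _"] adj2_adj2 ..
    also have "\<dots> = (M False False) ^ d * (of_real t * of_real s) ^ r * herm v v"
      using herm_kron_highest[of v r M, OF inv supp _ \<open>M False False \<noteq> 0\<close>] D unfolding det by simp
    \<comment> \<open>The shape of \<open>hyp2F1_generating\<close> with \<open>- \<i> * t\<close>
      and \<open>- \<i> * s\<close> substituted for the two variables.\<close>
    also have "(M False False) ^ d = ((1 + \<i>) / 4) ^ d *
        ((1 + - \<i> * of_real t) * (1 + - \<i> * of_real s) - 2 * (- \<i> * of_real t) * (- \<i> * of_real s)) ^ d"
      unfolding a by (simp add: power_mult_distrib[symmetric] algebra_simps)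
    also have "\<dots> * (of_real t * of_real s) ^ r * herm v v
        = (\<Sum>i\<le>d. \<Sum>j\<le>d. K i j * of_real t ^ (r + i) * of_real s ^ (r + j))"
      unfolding hyp2F1_generating K_def g_def
      by (simp only: sum_distrib_left sum_distrib_right power_mult_distrib power_add mult_ac)
    also have "\<dots> = (\<Sum>i\<le>CARD('n). \<Sum>j\<le>CARD('n). h i j * of_real t ^ i * of_real s ^ j)"
      using D by (subst (1 2) sum_shift_support[of r d "CARD('n)"])
        (auto simp: h_def intro!: sum.cong)
    finally show "(\<Sum>i\<le>CARD('n). \<Sum>j\<le>CARD('n). herm (E_mat i *v v) (E_eps j *v v) * of_real t ^ i * of_real s ^ j)
        = (\<Sum>i\<le>CARD('n). \<Sum>j\<le>CARD('n). h i j * of_real t ^ i * of_real s ^ j)" .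
  qed (use D assms in auto)
  then show ?thesis using assms by (simp add: h_def K_def g_def)
qed

section \<open>Weights of a T-module\<close>

lemma dual_support_iff:
  assumes "vec.subspace W"
  shows "k \<in> dual_support W \<longleftrightarrow> (\<exists>w\<in>W. E_dual k *v w \<noteq> 0)"
proof -
  have "k \<le> CARD('a)" if "E_dual k *v (w :: 'a::finite cvec) \<noteq> 0" for w
  proof (rule ccontr)
    assume "\<not> k \<le> CARD('a)"
    then have "E_dual k *v w = 0" using wt_le by (auto simp: vec_eq_iff E_dual_vec)
    with that show False by simp
  qed
  moreover have "0 \<in> mimage (E_dual k) W"
    unfolding mimage_def by (rule image_eqI[OF _ vec.subspace_0[OF assms]]) simp
  ultimately show ?thesis
    unfolding dual_support_def mimage_def by auto
qed

lemma kron_swap: "(kron (\<lambda>a b. of_bool (a \<noteq> b)) *v w) $ y = w $ (\<chi> k. \<not> y $ k)"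
proof -
  have "(\<Prod>k\<in>UNIV. of_bool (y $ k \<noteq> z $ k)) * w $ z
      = (if z = (\<chi> k. \<not> y $ k) then w $ z else 0)" for z
  proof (cases "z = (\<chi> k. \<not> y $ k)")
    case False
    then obtain k where "y $ k = z $ k" by (auto simp: vec_eq_iff)
    then have "(\<Prod>k\<in>UNIV. of_bool (y $ k \<noteq> z $ k) :: complex) = 0"
      by (intro prod_zero) auto
    with False show ?thesis by simp
  qed simp
  then show ?thesis by (simp add: kron_def matrix_vector_mult_def)
qed

lemma wt_compl: "wt (\<chi> k. \<not> y $ k) = CARD('n) - wt (y :: 'n::finite vertex)"
  by (simp add: wt_def Collect_neg_eq Compl_eq_Diff_UNIV card_Diff_subset)

lemma dual_support_sym:
  fixes W :: "'n::finite cvec set"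
  assumes "T_module W" and "k \<in> dual_support W"
  shows "CARD('n) - k \<in> dual_support W"
proof -
  interpret T_invariant W by unfold_locales fact
  let ?S = "kron (\<lambda>a b. of_bool (a \<noteq> b)) :: 'n cmat"
  obtain w where w: "w \<in> W" "E_dual k *v w \<noteq> 0"
    using assms(2) unfolding dual_support_iff[OF subspace] by blast
  then obtain y where y: "wt y = k" "w $ y \<noteq> 0"
    by (auto simp: vec_eq_iff E_dual_vec split: if_splits)
  have "(E_dual (CARD('n) - k) *v (?S *v w)) $ (\<chi> l. \<not> y $ l) = w $ y"
    unfolding E_dual_vec kron_swap by (simp add: wt_compl y vec_lambda_eta)
  with y(2) have "E_dual (CARD('n) - k) *v (?S *v w) \<noteq> 0"
    by (metis zero_index)
  with keepsD[OF keeps_swap \<open>w \<in> W\<close>] show ?thesis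
    unfolding dual_support_iff[OF subspace] by blast
qed

lemma finite_dual_support: "finite (dual_support W)"
  unfolding dual_support_def by simp

lemma herm_self_eq_0: "herm v v = 0 \<longleftrightarrow> v = 0"
  by (simp add: herm_self)

text \<open>The left side is the squared norm of the part of \<open>kron P1 *v v\<close> of weight
  \<open>k\<close>. That it is nonzero for \<open>v \<noteq> 0\<close> shows that each weight from
  \<open>r\<close> to \<open>r + d\<close> occurs in a T-module containing \<open>v\<close>.\<close>

lemma E_dual_kron_P1_highest:
  fixes v :: "'n::finite cvec"
  assumes inv: "\<And>b. kron (upper2 b) *v v = v" and supp: "\<And>y. wt y \<noteq> r \<Longrightarrow> v $ y = 0"
    and D: "CARD('n) = d + 2 * r" and k: "r \<le> k" "k \<le> r + d"
  shows "herm (E_dual k *v (kron P1 *v v)) (kron P1 *v v) = 4 ^ r * of_nat (d choose (k - r)) * herm v v"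
proof -
  define x where "x = kron P1 *v v"
  define h where "h k = (if r \<le> k \<and> k \<le> r + d then 4 ^ r * of_nat (d choose (k - r)) * herm v v else 0)" for k
  have "herm (E_dual k *v x) x = h k"
  proof (rule coeffs_eq_if_eq_on_pos[where n = "CARD('n)" and c = "\<lambda>k. herm (E_dual k *v x) x"])
    fix t :: real assume "t > 0"
    define M where "M = adj2 P1 \<odot> (diag2 1 (of_real t) \<odot> P1)"
    have a: "M False False = of_real t + 1"
      and det: "M False False * M True True - M False True * M True False = 4 * of_real t"
      unfolding M_def by (simp_all add: mat2_defs complex_eq_iff field_simps)
    have "M False False \<noteq> 0" using \<open>t > 0\<close> unfolding a by (simp add: complex_eq_iff)
    have "(\<Sum>i\<le>CARD('n). herm (E_dual i *v x) x * of_real t ^ i)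
        = herm (\<Sum>i\<le>CARD('n). of_real t ^ i *s (E_dual i *v x)) x"
      \<comment> \<open>A singleton index set presents the fixed second argument as a sum.\<close>
      using herm_sum[of "\<lambda>i. of_real t ^ i" "\<lambda>i. E_dual i *v x" "{..CARD('n)}" "\<lambda>_. 1" "\<lambda>_. x" "{0::nat}"]
      by (simp add: mult_ac)
    also have "\<dots> = herm (kron M *v v) v"
      unfolding sum_E_dual M_def x_def kron_kron[symmetric] herm_kron[of "adj2 _"] adj2_adj2 ..
    also have "\<dots> = (of_real t + 1) ^ d * (4 * of_real t) ^ r * herm v v"
      using herm_kron_highest[of v r M, OF inv supp _ \<open>M False False \<noteq> 0\<close>] D
      unfolding det unfolding a by simp
    also have "\<dots> = (\<Sum>i\<le>d. 4 ^ r * of_nat (d choose i) * herm v v * of_real t ^ (r + i))"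
      by (simp add: binomial_ring sum_distrib_left sum_distrib_right power_mult_distrib power_add mult_ac)
    also have "\<dots> = (\<Sum>i\<le>CARD('n). h i * of_real t ^ i)"
      using D by (subst sum_shift_support[of r d "CARD('n)"]) (auto simp: h_def intro!: sum.cong)
    finally show "(\<Sum>i\<le>CARD('n). herm (E_dual i *v x) x * of_real t ^ i)
      = (\<Sum>i\<le>CARD('n). h i * of_real t ^ i)" .
  qed (use D k in simp)
  then show ?thesis using k by (simp add: h_def x_def)
qed

lemma E_dual_below_endpoint:
  assumes "T_module W" "k < endpoint W" "w \<in> W"
  shows "E_dual k *v w = 0"
proof -
  have "k \<notin> dual_support W"
    using assms(2) Min_le[OF finite_dual_support, of k W] unfolding endpoint_def by force
  then show ?thesis
    using assms dual_support_iff unfolding T_module_def by blast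
qed

text \<open>With r the endpoint, \<open>dual_support_sym\<close> confines the weights of
  \<open>W\<close> to the interval from r to D - r, and \<open>kron P1 *v v\<close> has a nonzero
  part in each of them. So there are D - 2r + 1 weights.\<close>

lemma card_eq_diameter:
  fixes W :: "'n::finite cvec set"
  assumes W: "T_module W" and v: "v \<in> mimage (E_dual (endpoint W)) W" "v \<noteq> 0"
  shows "CARD('n) = diameter_T W + 2 * endpoint W"
proof -
  interpret T_invariant W by unfold_locales fact
  define r where "r = endpoint W"
  obtain w where w: "w \<in> W" "v = E_dual r *v w"
    using v unfolding mimage_def r_def by blast
  then have "r \<in> dual_support W"
    using v(2) unfolding dual_support_iff[OF subspace] by blast
  have min: "r \<le> k" if "k \<in> dual_support W" for k
    using Min_le[OF finite_dual_support that] unfolding r_def endpoint_def .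
  have "r \<le> CARD('n)" using \<open>r \<in> dual_support W\<close> unfolding dual_support_def by simp
  moreover have "r \<le> CARD('n) - r" by (intro min dual_support_sym W \<open>r \<in> dual_support W\<close>)
  ultimately obtain d where D: "CARD('n) = d + 2 * r"
    by (metis le_add_diff_inverse2 le_diff_conv2 mult_2)
  have "v \<in> W" using w keepsD[OF keeps_E_dual] by blast
  have supp: "v $ y = 0" if "wt y \<noteq> r" for y using that w by (simp add: E_dual_vec)
  have inv: "kron (upper2 b) *v v = v" for b
    using kron_upper_fixes[OF W \<open>v \<in> W\<close> supp] E_dual_below_endpoint[OF W] r_def by blast
  have "dual_support W = {r..r + d}"
  proof (intro set_eqI iffI)
    fix k assume k: "k \<in> dual_support W"
    then have "k \<le> CARD('n)" unfolding dual_support_def by simp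
    then show "k \<in> {r..r + d}"
      using min[OF k] min[OF dual_support_sym[OF W k]] D by auto
  next
    fix k assume "k \<in> {r..r + d}"
    then have "herm (E_dual k *v (kron P1 *v v)) (kron P1 *v v) \<noteq> 0"
      using v(2) by (subst E_dual_kron_P1_highest[OF inv supp D]) (auto simp: herm_self_eq_0)
    then have "E_dual k *v (kron P1 *v v) \<noteq> 0"
      by (auto simp: herm_def)
    with keepsD[OF keeps_P1 \<open>v \<in> W\<close>] show "k \<in> dual_support W"
      unfolding dual_support_iff[OF subspace] by blast
  qed
  then show ?thesis using D by (simp add: diameter_T_def r_def[symmetric])
qed

lemma herm_E_endpoint:
  fixes W :: "'n::finite cvec set"
  assumes W: "T_module W" and r: "r = endpoint W" and d: "d = diameter_T W" and ij: "i \<le> d" "j \<le> d"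
    and v: "v \<in> mimage (E_dual r) W" "v \<noteq> 0"
  shows "herm (E_mat (r + i) *v v) (E_eps (r + j) *v v)
    = \<i> powi (- int i - int j) * (2 - 2 * \<i>) powi (- int d) * herm v v
      * of_nat (d choose i) * of_nat (d choose j) * hyp2F1_two d i j"
proof -
  interpret T_invariant W by unfold_locales fact
  obtain w where w: "w \<in> W" "v = E_dual r *v w" using v unfolding mimage_def by blast
  have "v \<in> W" using w keepsD[OF keeps_E_dual] by blast
  have supp: "v $ y = 0" if "wt y \<noteq> r" for y using that w by (simp add: E_dual_vec)
  have inv: "kron (upper2 b) *v v = v" for b
    using kron_upper_fixes[OF W \<open>v \<in> W\<close> supp] E_dual_below_endpoint[OF W] r by blast
  have D: "CARD('n) = d + 2 * r"
    using card_eq_diameter[OF W] v r d by blast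
  have "\<i> powi (- int i - int j) = (- \<i>) ^ i * (- \<i>) ^ j"
  proof -
    have "- int i - int j = - int (i + j)" by simp
    then have "\<i> powi (- int i - int j) = inverse (\<i> ^ (i + j))"
      by (simp only: power_int_minus power_int_of_nat)
    then show ?thesis by (simp add: power_add flip: power_inverse)
  qed
  moreover have "(2 - 2 * \<i>) powi (- int d) = ((1 + \<i>) / 4) ^ d"
  proof -
    have "inverse (2 - 2 * \<i>) = (1 + \<i>) / 4"
      by (rule inverse_unique) (simp add: complex_eq_iff)
    moreover have "(2 - 2 * \<i>) powi (- int d) = inverse (2 - 2 * \<i>) ^ d"
      by (simp add: power_int_minus flip: power_inverse)
    ultimately show ?thesis by (simp only:)
  qed
  ultimately show ?thesis
    using herm_E_highest[OF inv supp D ij] by simp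
qed

section \<open>The cyclic symmetry of the idempotents\<close>

lemma kron_P1_cube:
  "kron P1 *v (kron P1 *v (kron P1 *v v)) = (2 - 2 * \<i>) ^ CARD('n) *s (v :: 'n::finite cvec)"
proof -
  have "P1 \<odot> (P1 \<odot> P1) = diag2 (2 - 2 * \<i>) (2 - 2 * \<i>)"
    by (intro ext) (auto simp: mat2_defs complex_eq_iff)
  then show ?thesis by (simp add: kron_kron kron_scalar)
qed

lemma kron_P1_P1: "kron P1 *v (kron P1 *v v) = (2 - 2 * \<i>) ^ CARD('n) *s (kron P1i *v (v :: 'n::finite cvec))"
  using kron_P1_cube[of "kron P1i *v v"] by (simp add: kron_P1_inverse)

lemma herm_kron_P1: "herm (kron P1 *v v) (kron P1 *v w) = 2 ^ CARD('n) * herm v (w :: 'n::finite cvec)"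
proof -
  have "adj2 P1 \<odot> P1 = diag2 2 2" by (intro ext) (auto simp: mat2_defs)
  then show ?thesis
    using herm_scale[of 1 v "2 ^ CARD('n)" w] by (simp add: herm_kron kron_kron kron_scalar)
qed

lemma E_mat_kron_P1: "E_mat i *v (kron P1 *v v) = kron P1 *v (E_eps i *v v)"
  by (simp add: E_eps_conj kron_P1_inverse)

lemma E_dual_kron_P1:
  assumes "i \<le> CARD('n::finite)"
  shows "E_dual i *v (kron P1 *v v) = kron P1 *v (E_mat i *v (v :: 'n cvec))"
  by (simp add: E_mat_conj[OF assms] kron_P1_inverse)

text \<open>This closes the cycle of the three families. It rests on the cube of
  \<open>kron P1\<close> being a scalar: two factors \<open>kron P1i\<close> amount to one factor
  \<open>kron P1\<close> up to that scalar.\<close>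

lemma E_eps_kron_P1:
  assumes "i \<le> CARD('n::finite)"
  shows "E_eps i *v (kron P1 *v v) = kron P1 *v (E_dual i *v (v :: 'n cvec))"
proof -
  have "E_eps i *v (kron P1 *v v) = kron P1i *v (kron P1i *v (E_dual i *v (kron P1 *v (kron P1 *v (kron P1 *v v)))))"
    by (simp add: E_eps_conj E_mat_conj[OF assms])
  also have "\<dots> = kron P1i *v ((2 - 2 * \<i>) ^ CARD('n) *s (kron P1i *v (E_dual i *v v)))"
    by (simp only: kron_P1_cube vector_scalar_commute)
  also have "\<dots> = kron P1 *v (E_dual i *v v)"
    by (simp only: kron_P1_P1[symmetric] kron_P1_inverse)
  finally show ?thesis .
qed

theorem theorem11p8:
  fixes W :: "('n::finite cvec) set" and u u_dual u_eps :: "'n cvec"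
    and r d i j :: nat
  assumes "irreducible_T_module W"
    and "r = endpoint W"
    and "d = diameter_T W"
    and "i \<le> d" and "j \<le> d"
    and "u \<in> mimage (E_mat r) W" and "u \<noteq> 0"
    and "u_dual \<in> mimage (E_dual r) W" and "u_dual \<noteq> 0"
    and "u_eps \<in> mimage (E_eps r) W" and "u_eps \<noteq> 0"
  shows "herm (E_mat (r + i) *v u_dual) (E_eps (r + j) *v u_dual)
      = \<i> powi (- int i - int j) * (2 - 2 * \<i>) powi (- int d) * of_real ((norm u_dual)\<^sup>2)
        * of_nat (d choose i) * of_nat (d choose j) * hyp2F1_two d i j
    \<and> herm (E_dual (r + i) *v u_eps) (E_mat (r + j) *v u_eps)
      = \<i> powi (- int i - int j) * (2 - 2 * \<i>) powi (- int d) * of_real ((norm u_eps)\<^sup>2)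
        * of_nat (d choose i) * of_nat (d choose j) * hyp2F1_two d i j
    \<and> herm (E_eps (r + i) *v u) (E_dual (r + j) *v u)
      = \<i> powi (- int i - int j) * (2 - 2 * \<i>) powi (- int d) * of_real ((norm u)\<^sup>2)
        * of_nat (d choose i) * of_nat (d choose j) * hyp2F1_two d i j"
proof -
  have W: "T_module W" using assms(1) unfolding irreducible_T_module_def by blast
  interpret T_invariant W by unfold_locales fact
  have "CARD('n) = d + 2 * r"
    using card_eq_diameter[OF W] assms(2,3,8,9) by blast
  then have le: "r \<le> CARD('n)" "r + i \<le> CARD('n)" "r + j \<le> CARD('n)"
    using assms(4,5) by simp_all
  note main = herm_E_endpoint[OF W assms(2-5)]
  have P1_neq_0: "kron P1 *v v \<noteq> 0" if "v \<noteq> 0" for v :: "'n cvec"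
    using that kron_P1_inverse(1)[of v] by auto
  obtain w where w: "w \<in> W" "u = E_mat r *v w"
    using assms(6) unfolding mimage_def by blast
  \<comment> \<open>Part (iii) is part (i) for \<open>kron P1 *v u\<close>, because
    \<open>kron P1\<close> carries the image of \<open>E_mat r\<close> on \<open>W\<close> into that
    of \<open>E_dual r\<close>.\<close>
  have "kron P1 *v u \<in> mimage (E_dual r) W"
    unfolding mimage_def w(2) E_dual_kron_P1[OF le(1), symmetric]
    using keepsD[OF keeps_P1 w(1)] by blast
  note * = main[OF this P1_neq_0[OF assms(7)]]
  obtain w' where w': "w' \<in> W" "u_eps = E_eps r *v w'"
    using assms(10) unfolding mimage_def by blast
  \<comment> \<open>Two applications of \<open>kron P1\<close> lead from \<open>E_eps\<close>
    through \<open>E_mat\<close> to \<open>E_dual\<close>, which gives part (ii).\<close>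
  have "kron P1 *v (kron P1 *v u_eps) \<in> mimage (E_dual r) W"
    unfolding mimage_def w'(2) E_mat_kron_P1[symmetric] E_dual_kron_P1[OF le(1), symmetric]
    using keepsD[OF keeps_P1 keepsD[OF keeps_P1 w'(1)]] by blast
  note ** = main[OF this P1_neq_0[OF P1_neq_0[OF assms(11)]]]
  \<comment> \<open>In the transported identities both sides carry the same power of 2 from
    \<open>herm_kron_P1\<close>, which cancels.\<close>
  show ?thesis
    using main[OF assms(8,9)] * **
    by (simp add: E_mat_kron_P1 E_eps_kron_P1 E_dual_kron_P1 le herm_kron_P1 flip: herm_self of_real_power)
qed

end
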